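(* Let $X$ be a Hausdorff Baire space, let $Y$ be a topological space, and let $f:X\to Y$ be a map whose graph $\{(x,f(x)) \mid x\in X\}\subset X\times Y$ is $\sigma$-compact. Then $f$ is continuous on a dense open subset of $X$, i.e. there is a dense open subset $U\subset X$ such that $f$ is continuous at every point of $U$.
   Context: A Baire space is a topological space in which every countable intersection of open dense subsets is dense. A subset of a topological space is $\sigma$-compact if it is a countable union of compact subsets; $X\times Y$ carries the product topology. No separation axiom is assumed on $Y$. The map $f$ is not assumed continuous. *)

theory Defs
  imports "HOL-Analysis.Analysis"
begin

(* The intersection is relativised to topspace X because the empty family has intersection UNIV. *)
definition Baire_space :: "'a topology \<Rightarrow> bool" where
  "Baire_space X \<longleftrightarrow>
     (\<forall>\<G>. countable \<G> \<and> (\<forall>G\<in>\<G>. openin X G \<and> X closure_of G = topspace X)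
        \<longrightarrow> X closure_of (topspace X \<inter> \<Inter>\<G>) = topspace X)"

definition sigma_compactin :: "'a topology \<Rightarrow> 'a set \<Rightarrow> bool" where
  "sigma_compactin X S \<longleftrightarrow>
     (\<exists>\<K>. countable \<K> \<and> (\<forall>K\<in>\<K>. compactin X K) \<and> S = \<Union>\<K>)"

end

theory Submission
  imports Defs
begin

text \<open>
  Write the graph of \<open>f\<close> as a countable union of compact sets \<open>K\<close>. Each projection
  \<open>A = fst ` K\<close> is compact, hence closed, and the restriction of \<open>f\<close> to \<open>A\<close> is continuous because
  the preimage of a closed \<open>C\<close> under it is the projection of the compact set \<open>K \<inter> (X \<times> C)\<close>.
  The sets \<open>A\<close> cover \<open>X\<close>, so by the Baire property the union of their interiors is dense.
\<close>

text \<open>A closed \<open>A\<close> contains its frontier, so the interior of the frontier lies in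
  the interior of \<open>A\<close>, which the frontier avoids. Hence the frontier has empty interior
  and its complement is dense.\<close>

lemma dense_openin_compl_frontier:
  assumes "closedin X A"
  shows "openin X (topspace X - X frontier_of A)"
    and "X closure_of (topspace X - X frontier_of A) = topspace X"
proof -
  show "openin X (topspace X - X frontier_of A)"
    by (simp add: closedin_frontier_of openin_diff)
  have "X interior_of (X frontier_of A) \<subseteq> X interior_of A"
    using frontier_of_subset_closedin[OF assms] by (rule interior_of_mono)
  moreover have "X interior_of (X frontier_of A) \<inter> X interior_of A = {}"
    using interior_of_subset[of X "X frontier_of A"] by (auto simp: frontier_of_def)
  ultimately have "X interior_of (X frontier_of A) = {}" by blast
  then show "X closure_of (topspace X - X frontier_of A) = topspace X"
    by (simp add: closure_of_complement)
qed

text \<open>The Baire property is applied to the complements of the frontiers: a point on no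
  frontier is interior to any member of the cover that contains it.\<close>

lemma Baire_space_dense_Union_interior:
  assumes "Baire_space X" and "countable \<A>" and "\<And>A. A \<in> \<A> \<Longrightarrow> closedin X A"
    and cover: "topspace X \<subseteq> \<Union>\<A>"
  shows "X closure_of (\<Union>A\<in>\<A>. X interior_of A) = topspace X"
proof -
  define \<G> where "\<G> = (\<lambda>A. topspace X - X frontier_of A) ` \<A>"
  have "countable \<G>" and "\<forall>G\<in>\<G>. openin X G \<and> X closure_of G = topspace X"
    using assms dense_openin_compl_frontier[of X] by (auto simp: \<G>_def)
  then have dense: "X closure_of (topspace X \<inter> \<Inter>\<G>) = topspace X"
    using assms(1) by (auto simp: Baire_space_def)
  have "topspace X \<inter> \<Inter>\<G> \<subseteq> (\<Union>A\<in>\<A>. X interior_of A)"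
  proof
    fix x assume x: "x \<in> topspace X \<inter> \<Inter>\<G>"
    then obtain A where A: "A \<in> \<A>" "x \<in> A" using cover by auto
    then have "x \<notin> X frontier_of A" using x unfolding \<G>_def by blast
    \<comment> \<open>A point of \<open>A\<close> lies in the closure of \<open>A\<close>, and the
      frontier is the closure minus the interior.\<close>
    then show "x \<in> (\<Union>A\<in>\<A>. X interior_of A)"
      using A x closure_of_subset_Int[of X A] by (auto simp: frontier_of_def)
  qed
  then have "topspace X \<subseteq> X closure_of (\<Union>A\<in>\<A>. X interior_of A)"
    using closure_of_mono dense by fastforce
  then show ?thesis
    by (simp add: closure_of_subset_topspace subset_antisym)
qed

text \<open>Serves both for the pieces \<open>K\<close> of the graph and for their parts lying over
  a closed subset of \<open>Y\<close>.\<close>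

lemma closedin_fst_image_compactin:
  assumes "Hausdorff_space X" and "compactin (prod_topology X Y) K"
  shows "closedin X (fst ` K)"
  using image_compactin[OF assms(2) continuous_map_fst] assms(1)
  by (rule compactin_imp_closedin[rotated])

lemma topcontinuous_at_interior_of_compactin_graph:
  assumes "Hausdorff_space X" and f: "f \<in> topspace X \<rightarrow> topspace Y"
    and K: "compactin (prod_topology X Y) K" and graph: "\<And>p. p \<in> K \<Longrightarrow> snd p = f (fst p)"
    and x: "x \<in> X interior_of (fst ` K)"
  shows "topcontinuous_at X Y f x"
  unfolding topcontinuous_at_def
proof (intro conjI allI impI)
  show "x \<in> topspace X" using x interior_of_subset_topspace by fastforce
  show "f \<in> topspace X \<rightarrow> topspace Y" by (rule f)
  fix V assume V: "openin Y V \<and> f x \<in> V"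
  \<comment> \<open>By \<open>graph\<close>, \<open>B\<close> consists of the points in the
    projection of \<open>K\<close> that \<open>f\<close> sends outside \<open>V\<close>. Removing it
    from the interior of that projection leaves the required neighbourhood of
    \<open>x\<close>.\<close>
  define B where "B = fst ` (K \<inter> (topspace X \<times> (topspace Y - V)))"
  have "closedin (prod_topology X Y) (topspace X \<times> (topspace Y - V))"
    using V by (auto simp: closedin_prod_Times_iff)
  then have "compactin (prod_topology X Y) (K \<inter> (topspace X \<times> (topspace Y - V)))"
    using K by (simp add: compact_Int_closedin)
  then have "closedin X B"
    unfolding B_def using assms(1) by (intro closedin_fst_image_compactin)
  moreover have "x \<notin> B" using V graph by (auto simp: B_def)
  moreover have "f y \<in> V" if y: "y \<in> X interior_of (fst ` K) - B" for y
  proof -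
    \<comment> \<open>The point of \<open>K\<close> over \<open>y\<close> is
      \<open>(y, f y)\<close>; if \<open>f y\<close> were outside \<open>V\<close>, it would put
      \<open>y\<close> into \<open>B\<close>.\<close>
    obtain p where p: "p \<in> K" "fst p = y" using y interior_of_subset by fast
    then have "p \<in> topspace X \<times> topspace Y" using compactin_subset_topspace[OF K] by auto
    then show ?thesis using p y graph by (cases p) (force simp: B_def)
  qed
  ultimately show "\<exists>U. openin X U \<and> x \<in> U \<and> (\<forall>y\<in>U. f y \<in> V)"
    using x by (intro exI[of _ "X interior_of (fst ` K) - B"]) auto
qed

theorem lemma1p1:
  fixes X :: "'a topology" and Y :: "'b topology" and f :: "'a \<Rightarrow> 'b"
  assumes "Hausdorff_space X"
    and "Baire_space X"
    and "f \<in> topspace X \<rightarrow> topspace Y"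
    and "sigma_compactin (prod_topology X Y) {(x, f x) | x. x \<in> topspace X}"
  shows "\<exists>U. openin X U \<and> X closure_of U = topspace X \<and> (\<forall>x\<in>U. topcontinuous_at X Y f x)"
proof -
  obtain \<K> where "countable \<K>" and K: "\<And>K. K \<in> \<K> \<Longrightarrow> compactin (prod_topology X Y) K"
    and graph: "{(x, f x) | x. x \<in> topspace X} = \<Union>\<K>"
    using assms(4) unfolding sigma_compactin_def
    by (elim exE conjE) (rule that; (assumption | erule (1) bspec))
  define U where "U = (\<Union>A\<in>(`) fst ` \<K>. X interior_of A)"
  have "closedin X (fst ` K)" if "K \<in> \<K>" for K
    using assms(1) K[OF that] by (rule closedin_fst_image_compactin)
  moreover have "topspace X \<subseteq> \<Union>((`) fst ` \<K>)"
  proof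
    fix x assume "x \<in> topspace X"
    then have "(x, f x) \<in> \<Union>\<K>" unfolding graph[symmetric] by blast
    then show "x \<in> \<Union>((`) fst ` \<K>)" by force
  qed
  ultimately have "X closure_of U = topspace X"
    unfolding U_def using assms(2) \<open>countable \<K>\<close>
    by (intro Baire_space_dense_Union_interior) auto
  moreover have "topcontinuous_at X Y f x" if xU: "x \<in> U" for x
  proof -
    obtain K' where K': "K' \<in> \<K>" "x \<in> X interior_of (fst ` K')"
      using xU by (auto simp: U_def)
    \<comment> \<open>Each compact piece is part of the graph, so \<open>f\<close> is read off from
      it on its whole projection.\<close>
    have "snd p = f (fst p)" if "p \<in> K'" for p
    proof -
      have "p \<in> {(x, f x) | x. x \<in> topspace X}" unfolding graph using that K'(1) by blast
      then show ?thesis by auto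
    qed
    then show ?thesis
      by (intro topcontinuous_at_interior_of_compactin_graph[OF assms(1,3) K[OF K'(1)] _ K'(2)])
  qed
  moreover have "openin X U" by (auto simp: U_def)
  ultimately show ?thesis by blast
qed

end
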